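(* Let $E\colon 0\to M\xrightarrow{i}E\xrightarrow{p}A\to 0$ be an abelian extension of an algebra with bracket $A$ by its representation $M$, and let $\omega\colon D_{\mathsf{AWB}}(M,A)\to H^1_{\mathsf{AWB}}(A,M)$ be the associated Wells map. A pair $(d_M,d_A)\in \mathrm{Der}_{\mathsf{AWB}}(M)\times \mathrm{Der}_{\mathsf{AWB}}(A)$ is extensible if and only if $(d_M,d_A)\in D_{\mathsf{AWB}}(M,A)$ and $\omega(d_M,d_A)=0$.
   Context: Fix a field $\mathbb K$; all vector spaces, algebras and linear maps are over $\mathbb K$. An algebra with bracket (AWB) is an associative (not necessarily commutative or unital) algebra $A$ with a bilinear map $[-,-]\colon A\times A\to A$ such that $[ab,c]=[a,c]b+a[b,c]$ for all $a,b,c\in A$. Homomorphisms preserve product and bracket. An AWB is abelian if its product and bracket are zero; any vector space is regarded as an abelian AWB. A representation of $A$ is a vector space $M$ with four bilinear maps $A\times M\to M$, $(a,m)\mapsto a\cdot m$ and $(a,m)\mapsto\{a,m\}$, and $M\times A\to M$, $(m,a)\mapsto m\cdot a$ and $(m,a)\mapsto\{m,a\}$, such that $(a_1a_2)\cdot m=a_1\cdot(a_2\cdot m)$, $m\cdot(a_1a_2)=(m\cdot a_1)\cdot a_2$, $(a_1\cdot m)\cdot a_2=a_1\cdot(m\cdot a_2)$, $\{a_1\cdot m,a_2\}=a_1\cdot\{m,a_2\}+[a_1,a_2]\cdot m$, $\{m\cdot a_1,a_2\}=\{m,a_2\}\cdot a_1+m\cdot[a_1,a_2]$, $\{a_1a_2,m\}=a_1\cdot\{a_2,m\}+\{a_1,m\}\cdot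 a_2$. An abelian extension of $A$ by $M$ is a short exact sequence of AWBs $0\to M\xrightarrow{i}E\xrightarrow{p}A\to0$ with $M$ regarded as an abelian AWB, which induces the given representation structure on $M$: for any $e\in E$ with $p(e)=a$ one has $i(a\cdot m)=e\,i(m)$, $i(m\cdot a)=i(m)e$, $i\{a,m\}=[e,i(m)]$, $i\{m,a\}=[i(m),e]$. (The letter $E$ denotes both the extension and its middle term.) For an AWB $X$, $\mathrm{Der}_{\mathsf{AWB}}(X)$ is the space of linear maps $d\colon X\to X$ with $d(xy)=x\,d(y)+d(x)y$ and $d[x,y]=[x,d(y)]+[d(x),y]$. In particular $\mathrm{Der}_{\mathsf{AWB}}(M)=\mathrm{End}_{\mathbb K}(M)$ for the abelian AWB $M$. A pair $(d_M,d_A)\in\mathrm{Der}_{\mathsf{AWB}}(M)\times\mathrm{Der}_{\mathsf{AWB}}(A)$ is extensible if there is $d_E\in\mathrm{Der}_{\mathsf{AWB}}(E)$ with $d_E\circ i=i\circ d_M$ and $p\circ d_E=d_A\circ p$. $D_{\mathsf{AWB}}(M,A)$ is the set of pairs $(d_M,d_A)\in\mathrm{Der}_{\mathsf{AWB}}(M)\times\mathrm{Der}_{\mathsf{AWB}}(A)$ such that for all $a\in A$, $m\in M$: $d_M(a\cdot m)=a\cdot d_M(m)+d_A(a)\cdot m$, $d_M(m\cdot a)=m\cdot d_A(a)+d_M(m)\cdot a$, $d_M\{a,m\}=\{a,d_M(m)\}+\{d_A(a),m\}$, $d_M\{m,a\}=\{m,d_A(a)\}+\{d_M(m),a\}$.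 Cohomology: a $0$-cochain is a pair $(f,g)$ of linear maps $f\colon A^{\otimes2}\to M$, $g\colon A\to\mathrm{Hom}(A,M)$. It is a $0$-cocycle if for all $a_0,a_1,a_2\in A$ $$a_0\cdot f(a_1,a_2)-f(a_0a_1,a_2)+f(a_0,a_1a_2)-f(a_0,a_1)\cdot a_2=0,$$ $$a_0\cdot g(a_1)(a_2)+g(a_0)(a_2)\cdot a_1-g(a_0a_1)(a_2)=\{f(a_0,a_1),a_2\}-f([a_0,a_2],a_1)-f(a_0,[a_1,a_2]).$$ For a linear map $h\colon A\to M$, $\partial^{-1}(h)$ is the pair $(f,g)$ with $f(a_0,a_1)=-a_0\cdot h(a_1)+h(a_0a_1)-h(a_0)\cdot a_1$ and $g(a_0)(a_1)=-\{a_0,h(a_1)\}+h[a_0,a_1]-\{h(a_0),a_1\}$. $H^1_{\mathsf{AWB}}(A,M)$ is the quotient of the space of $0$-cocycles by the image of $\partial^{-1}$; $\mathrm{cl}$ denotes classes. Wells map: choose a linear section $s\colon A\to E$ of $p$ and set $f(a_0,a_1)=i^{-1}(s(a_0)s(a_1)-s(a_0a_1))$, $g(a_0)(a_1)=i^{-1}([s(a_0),s(a_1)]-s[a_0,a_1])$; this is a $0$-cocycle whose class does not depend on $s$. Then $\omega(d_M,d_A)=\mathrm{cl}(f_\theta,g_\theta)$, where $$f_\theta(a_0,a_1)=d_M(f(a_0,a_1))-f(d_A(a_0),a_1)-f(a_0,d_A(a_1)),$$ $$g_\theta(a_0)(a_1)=d_M(g(a_0)(a_1))-g(d_A(a_0))(a_1)-g(a_0)(d_A(a_1)).$$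 This is a well-defined map. *)

theory Defs
  imports Complex_Main
begin

text \<open>Vector spaces are whole types of class \<open>ab_group_add\<close> with an explicit scalar
  multiplication, as in the locale \<open>vector_space\<close>. The unqualified name \<open>linear\<close>
  means real-linear maps here, so linearity over an arbitrary field is \<open>Vector_Spaces.linear\<close>.\<close>

definition bilinear_map ::
  "('k::field \<Rightarrow> 'u::ab_group_add \<Rightarrow> 'u) \<Rightarrow> ('k \<Rightarrow> 'v::ab_group_add \<Rightarrow> 'v) \<Rightarrow>
   ('k \<Rightarrow> 'w::ab_group_add \<Rightarrow> 'w) \<Rightarrow> ('u \<Rightarrow> 'v \<Rightarrow> 'w) \<Rightarrow> bool" where
  "bilinear_map s1 s2 s3 b \<longleftrightarrow>
     (\<forall>x. Vector_Spaces.linear s2 s3 (\<lambda>y. b x y)) \<and>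
     (\<forall>y. Vector_Spaces.linear s1 s3 (\<lambda>x. b x y))"


subsection \<open>Algebras with bracket\<close>

record ('k, 'v) awb =
  smul :: "'k \<Rightarrow> 'v \<Rightarrow> 'v"
  mult :: "'v \<Rightarrow> 'v \<Rightarrow> 'v"
  brkt :: "'v \<Rightarrow> 'v \<Rightarrow> 'v"

locale AWB =
  fixes A :: "('k::field, 'a::ab_group_add) awb"
  assumes vector_space_smul: "vector_space (smul A)"
    and bilinear_mult: "bilinear_map (smul A) (smul A) (smul A) (mult A)"
    and bilinear_brkt: "bilinear_map (smul A) (smul A) (smul A) (brkt A)"
    and mult_assoc: "mult A (mult A a b) c = mult A a (mult A b c)"
    and brkt_mult: "brkt A (mult A a b) c = mult A (brkt A a c) b + mult A a (brkt A b c)"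

definition awb_hom ::
  "('k::field, 'a::ab_group_add) awb \<Rightarrow> ('k, 'b::ab_group_add) awb \<Rightarrow> ('a \<Rightarrow> 'b) \<Rightarrow> bool" where
  "awb_hom A B \<phi> \<longleftrightarrow>
     Vector_Spaces.linear (smul A) (smul B) \<phi> \<and>
     (\<forall>x y. \<phi> (mult A x y) = mult B (\<phi> x) (\<phi> y)) \<and>
     (\<forall>x y. \<phi> (brkt A x y) = brkt B (\<phi> x) (\<phi> y))"

definition abelian_awb :: "('k::field \<Rightarrow> 'm::ab_group_add \<Rightarrow> 'm) \<Rightarrow> ('k, 'm) awb" where
  "abelian_awb s = \<lparr>smul = s, mult = (\<lambda>_ _. 0), brkt = (\<lambda>_ _. 0)\<rparr>"

definition Der_AWB :: "('k::field, 'a::ab_group_add) awb \<Rightarrow> ('a \<Rightarrow> 'a) set" where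
  "Der_AWB X = {d. Vector_Spaces.linear (smul X) (smul X) d \<and>
     (\<forall>x y. d (mult X x y) = mult X x (d y) + mult X (d x) y) \<and>
     (\<forall>x y. d (brkt X x y) = brkt X x (d y) + brkt X (d x) y)}"


subsection \<open>Representations\<close>

text \<open>The fields \<open>lact\<close>, \<open>ract\<close>, \<open>lbr\<close>, \<open>rbr\<close> are the maps
  $a \cdot m$, $m \cdot a$, $\{a, m\}$, $\{m, a\}$, with the arguments in this order.\<close>

record ('k, 'a, 'm) awb_rep =
  rsmul :: "'k \<Rightarrow> 'm \<Rightarrow> 'm"
  lact :: "'a \<Rightarrow> 'm \<Rightarrow> 'm"
  ract :: "'m \<Rightarrow> 'a \<Rightarrow> 'm"
  lbr :: "'a \<Rightarrow> 'm \<Rightarrow> 'm"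
  rbr :: "'m \<Rightarrow> 'a \<Rightarrow> 'm"

locale AWB_rep = AWB A
  for A :: "('k::field, 'a::ab_group_add) awb" +
  fixes M :: "('k, 'a, 'm::ab_group_add) awb_rep"
  assumes vector_space_rsmul: "vector_space (rsmul M)"
    and bilinear_lact: "bilinear_map (smul A) (rsmul M) (rsmul M) (lact M)"
    and bilinear_ract: "bilinear_map (rsmul M) (smul A) (rsmul M) (ract M)"
    and bilinear_lbr: "bilinear_map (smul A) (rsmul M) (rsmul M) (lbr M)"
    and bilinear_rbr: "bilinear_map (rsmul M) (smul A) (rsmul M) (rbr M)"
    and lact_mult: "lact M (mult A a1 a2) m = lact M a1 (lact M a2 m)"
    and ract_mult: "ract M m (mult A a1 a2) = ract M (ract M m a1) a2"
    and ract_lact: "ract M (lact M a1 m) a2 = lact M a1 (ract M m a2)"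
    and rbr_lact: "rbr M (lact M a1 m) a2 = lact M a1 (rbr M m a2) + lact M (brkt A a1 a2) m"
    and rbr_ract: "rbr M (ract M m a1) a2 = ract M (rbr M m a2) a1 + ract M m (brkt A a1 a2)"
    and lbr_mult: "lbr M (mult A a1 a2) m = lact M a1 (lbr M a2 m) + ract M (lbr M a1 m) a2"

abbreviation rep_awb :: "('k::field, 'a::ab_group_add, 'm::ab_group_add) awb_rep \<Rightarrow> ('k, 'm) awb" where
  "rep_awb M \<equiv> abelian_awb (rsmul M)"


subsection \<open>Abelian extensions\<close>

locale abelian_extension = AWB_rep A M + E: AWB E
  for A :: "('k::field, 'a::ab_group_add) awb"
    and M :: "('k, 'a, 'm::ab_group_add) awb_rep"
    and E :: "('k, 'e::ab_group_add) awb" +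
  fixes i :: "'m \<Rightarrow> 'e" and p :: "'e \<Rightarrow> 'a"
  assumes hom_i: "awb_hom (rep_awb M) E i"
    and hom_p: "awb_hom E A p"
    and inj_i: "inj i"
    and surj_p: "surj p"
    and exact: "range i = {e. p e = 0}"
    and induced_lact: "i (lact M (p e) m) = mult E e (i m)"
    and induced_ract: "i (ract M m (p e)) = mult E (i m) e"
    and induced_lbr: "i (lbr M (p e) m) = brkt E e (i m)"
    and induced_rbr: "i (rbr M m (p e)) = brkt E (i m) e"

definition extensible ::
  "('k::field, 'e::ab_group_add) awb \<Rightarrow> ('m \<Rightarrow> 'e) \<Rightarrow> ('e \<Rightarrow> 'a) \<Rightarrow> ('m \<Rightarrow> 'm) \<times> ('a \<Rightarrow> 'a) \<Rightarrow> bool" where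
  "extensible E i p = (\<lambda>(dM, dA). \<exists>dE \<in> Der_AWB E. dE \<circ> i = i \<circ> dM \<and> p \<circ> dE = dA \<circ> p)"

definition D_AWB ::
  "('k::field, 'a::ab_group_add) awb \<Rightarrow> ('k, 'a, 'm::ab_group_add) awb_rep \<Rightarrow>
   (('m \<Rightarrow> 'm) \<times> ('a \<Rightarrow> 'a)) set" where
  "D_AWB A M = {(dM, dA). dM \<in> Der_AWB (rep_awb M) \<and> dA \<in> Der_AWB A \<and>
     (\<forall>a m. dM (lact M a m) = lact M a (dM m) + lact M (dA a) m \<and>
            dM (ract M m a) = ract M m (dA a) + ract M (dM m) a \<and>
            dM (lbr M a m) = lbr M a (dM m) + lbr M (dA a) m \<and>
            dM (rbr M m a) = rbr M m (dA a) + rbr M (dM m) a)}"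


subsection \<open>Cohomology\<close>

text \<open>A linear map $A \otimes A \to M$ and a linear map $A \to \mathrm{Hom}(A, M)$ are both
  represented by curried bilinear functions.\<close>

type_synonym ('a, 'm) cochain0 = "('a \<Rightarrow> 'a \<Rightarrow> 'm) \<times> ('a \<Rightarrow> 'a \<Rightarrow> 'm)"

definition cochains0 ::
  "('k::field, 'a::ab_group_add) awb \<Rightarrow> ('k, 'a, 'm::ab_group_add) awb_rep \<Rightarrow> ('a, 'm) cochain0 set" where
  "cochains0 A M = {(f, g). bilinear_map (smul A) (smul A) (rsmul M) f \<and>
                            bilinear_map (smul A) (smul A) (rsmul M) g}"

definition cocycles0 ::
  "('k::field, 'a::ab_group_add) awb \<Rightarrow> ('k, 'a, 'm::ab_group_add) awb_rep \<Rightarrow> ('a, 'm) cochain0 set" where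
  "cocycles0 A M = {(f, g). (f, g) \<in> cochains0 A M \<and>
     (\<forall>a0 a1 a2. lact M a0 (f a1 a2) - f (mult A a0 a1) a2 + f a0 (mult A a1 a2)
                   - ract M (f a0 a1) a2 = 0) \<and>
     (\<forall>a0 a1 a2. lact M a0 (g a1 a2) + ract M (g a0 a2) a1 - g (mult A a0 a1) a2
                   = rbr M (f a0 a1) a2 - f (brkt A a0 a2) a1 - f a0 (brkt A a1 a2))}"

definition coboundary ::
  "('k::field, 'a::ab_group_add) awb \<Rightarrow> ('k, 'a, 'm::ab_group_add) awb_rep \<Rightarrow>
   ('a \<Rightarrow> 'm) \<Rightarrow> ('a, 'm) cochain0" where
  "coboundary A M h =
     (\<lambda>a0 a1. - lact M a0 (h a1) + h (mult A a0 a1) - ract M (h a0) a1,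
      \<lambda>a0 a1. - lbr M a0 (h a1) + h (brkt A a0 a1) - rbr M (h a0) a1)"

definition cohomologous ::
  "('k::field, 'a::ab_group_add) awb \<Rightarrow> ('k, 'a, 'm::ab_group_add) awb_rep \<Rightarrow>
   (('a, 'm) cochain0 \<times> ('a, 'm) cochain0) set" where
  "cohomologous A M = {((f, g), (f', g')).
     (f, g) \<in> cocycles0 A M \<and> (f', g') \<in> cocycles0 A M \<and>
     (\<exists>h. Vector_Spaces.linear (smul A) (rsmul M) h \<and>
        (\<lambda>a0 a1. f a0 a1 - f' a0 a1, \<lambda>a0 a1. g a0 a1 - g' a0 a1) = coboundary A M h)}"

definition H1_AWB ::
  "('k::field, 'a::ab_group_add) awb \<Rightarrow> ('k, 'a, 'm::ab_group_add) awb_rep \<Rightarrow>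
   ('a, 'm) cochain0 set set" where
  "H1_AWB A M = cocycles0 A M // cohomologous A M"

definition cl ::
  "('k::field, 'a::ab_group_add) awb \<Rightarrow> ('k, 'a, 'm::ab_group_add) awb_rep \<Rightarrow>
   ('a, 'm) cochain0 \<Rightarrow> ('a, 'm) cochain0 set" where
  "cl A M c = cohomologous A M `` {c}"

definition H1_zero ::
  "('k::field, 'a::ab_group_add) awb \<Rightarrow> ('k, 'a, 'm::ab_group_add) awb_rep \<Rightarrow>
   ('a, 'm) cochain0 set" where
  "H1_zero A M = cl A M (\<lambda>_ _. 0, \<lambda>_ _. 0)"


subsection \<open>The Wells map\<close>

definition linear_section ::
  "('k::field, 'a::ab_group_add) awb \<Rightarrow> ('k, 'e::ab_group_add) awb \<Rightarrow> ('e \<Rightarrow> 'a) \<Rightarrow> ('a \<Rightarrow> 'e) \<Rightarrow> bool" where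
  "linear_section A E p s \<longleftrightarrow> Vector_Spaces.linear (smul A) (smul E) s \<and> p \<circ> s = id"

definition section_cocycle ::
  "('k::field, 'a::ab_group_add) awb \<Rightarrow> ('k, 'e::ab_group_add) awb \<Rightarrow> ('m \<Rightarrow> 'e) \<Rightarrow> ('a \<Rightarrow> 'e) \<Rightarrow>
   ('a, 'm) cochain0" where
  "section_cocycle A E i s =
     (\<lambda>a0 a1. inv i (mult E (s a0) (s a1) - s (mult A a0 a1)),
      \<lambda>a0 a1. inv i (brkt E (s a0) (s a1) - s (brkt A a0 a1)))"

definition theta_cochain ::
  "('m::ab_group_add \<Rightarrow> 'm) \<times> ('a \<Rightarrow> 'a) \<Rightarrow> ('a, 'm) cochain0 \<Rightarrow> ('a, 'm) cochain0" where
  "theta_cochain = (\<lambda>(dM, dA) (f, g).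
     (\<lambda>a0 a1. dM (f a0 a1) - f (dA a0) a1 - f a0 (dA a1),
      \<lambda>a0 a1. dM (g a0 a1) - g (dA a0) a1 - g a0 (dA a1)))"

text \<open>The section is chosen by \<open>SOME\<close>; as the class does not depend on the section, this is the
  Wells map. It is meaningful only for arguments in \<open>D_AWB A M\<close>.\<close>

definition wells_map ::
  "('k::field, 'a::ab_group_add) awb \<Rightarrow> ('k, 'a, 'm::ab_group_add) awb_rep \<Rightarrow>
   ('k, 'e::ab_group_add) awb \<Rightarrow> ('m \<Rightarrow> 'e) \<Rightarrow> ('e \<Rightarrow> 'a) \<Rightarrow>
   ('m \<Rightarrow> 'm) \<times> ('a \<Rightarrow> 'a) \<Rightarrow> ('a, 'm) cochain0 set" where
  "wells_map A M E i p d =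
     (let s = (SOME s. linear_section A E p s)
      in cl A M (theta_cochain d (section_cocycle A E i s)))"

end

theory Submission
  imports Defs
begin

text \<open>Fix a linear section \<open>s\<close>, so that \<open>E = i(M) \<oplus> s(A)\<close>, with cocycle \<open>(f, g)\<close>. A linear map
  \<open>dE\<close> lifting \<open>(dM, dA)\<close> has the form \<open>i m + s a \<mapsto> i (dM m) + s (dA a) - i (h a)\<close> for a unique
  linear \<open>h : A \<rightarrow> M\<close>. Comparing both sides of the product rule on \<open>(i m + s a) (i n + s b)\<close>, the terms
  mixing \<open>M\<close> and \<open>A\<close> give the compatibility of \<open>dM\<close> with the actions, and the terms on \<open>s a, s b\<close>
  give \<open>f\<^sub>\<theta> = \<partial>h\<close>. The bracket behaves in exactly the same way, because the argument uses no
  identities of the operation beyond biadditivity.\<close>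

section \<open>Extensions with a biadditive operation\<close>

text \<open>\<open>E\<close> and \<open>A\<close> are bare operations rather than records, so that
  one locale is interpreted twice, for product and bracket. Only addition is recorded; linearity
  over the field is treated separately.\<close>

locale biadditive_extension =
  fixes i :: "'m::ab_group_add \<Rightarrow> 'e::ab_group_add" and p :: "'e \<Rightarrow> 'a::ab_group_add"
    and s :: "'a \<Rightarrow> 'e"
    and E :: "'e \<Rightarrow> 'e \<Rightarrow> 'e" and A :: "'a \<Rightarrow> 'a \<Rightarrow> 'a"
    and l :: "'a \<Rightarrow> 'm \<Rightarrow> 'm" and r :: "'m \<Rightarrow> 'a \<Rightarrow> 'm"
  assumes additive_i: "additive i" and additive_p: "additive p" and additive_s: "additive s"
    and inj_i: "inj i" and exact: "range i = {e. p e = 0}" and p_s: "p (s a) = a"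
    and additive_E_right: "additive (E x)" and additive_E_left: "additive (\<lambda>x. E x y)"
    and additive_l: "additive (\<lambda>a. l a m)"
    and p_E: "p (E x y) = A (p x) (p y)"
    and i_l: "i (l (p e) m) = E e (i m)"
    and i_r: "i (r m (p e)) = E (i m) e"
begin

definition factor_set :: "'a \<Rightarrow> 'a \<Rightarrow> 'm" where
  "factor_set a b = inv i (E (s a) (s b) - s (A a b))"

lemmas additive_simps =
  additive.add[OF additive_i] additive.diff[OF additive_i] additive.zero[OF additive_i]
  additive.minus[OF additive_i]
  additive.add[OF additive_p] additive.diff[OF additive_p] additive.zero[OF additive_p]
  additive.add[OF additive_s] additive.diff[OF additive_s] additive.zero[OF additive_s]
  additive.add[OF additive_E_right] additive.diff[OF additive_E_right]
  additive.add[OF additive_E_left] additive.diff[OF additive_E_left]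

lemma p_i [simp]: "p (i m) = 0"
  using exact by auto

lemma i_inv: "p e = 0 \<Longrightarrow> i (inv i e) = e"
  using exact by (intro f_inv_into_f) auto

lemma i_factor_set: "i (factor_set a b) = E (s a) (s b) - s (A a b)"
  unfolding factor_set_def by (rule i_inv) (simp add: additive_simps p_E p_s)

text \<open>Multiplying by \<open>i m\<close> acts on \<open>i n\<close> through
  \<open>p (i m) = 0\<close>.\<close>

lemma E_i_i: "E (i m) (i n) = 0"
  using i_l[of "i m" n] by (simp add: additive_simps additive.zero[OF additive_l])

lemma E_s_i: "E (s a) (i m) = i (l a m)"
  using i_l[of "s a" m] by (simp add: p_s)

lemma E_i_s: "E (i m) (s a) = i (r m a)"
  using i_r[of m "s a"] by (simp add: p_s)

lemma E_s_s: "E (s a) (s b) = i (factor_set a b) + s (A a b)"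
  by (simp add: i_factor_set)

lemma decomp: "\<exists>m. e = i m + s (p e)"
  using i_inv[of "e - s (p e)"] by (metis additive_simps(6) diff_add_cancel diff_self p_s)

text \<open>Both identities come from applying \<open>dE\<close> to the mixed products
  \<open>E (s a) (i m)\<close> and \<open>E (i m) (s a)\<close>, which lie in the image of the
  injective map \<open>i\<close>.\<close>

lemma lift_compatible:
  assumes dE: "\<And>x y. dE (E x y) = E x (dE y) + E (dE x) y"
    and dE_i: "\<And>m. dE (i m) = i (dM m)" and p_dE: "\<And>e. p (dE e) = dA (p e)"
  shows "dM (l a m) = l a (dM m) + l (dA a) m"
    and "dM (r m a) = r m (dA a) + r (dM m) a"
proof -
  have "i (dM (l a m)) = dE (E (s a) (i m))"
    by (simp add: E_s_i dE_i)
  also have "\<dots> = E (s a) (i (dM m)) + E (dE (s a)) (i m)"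
    by (simp add: dE dE_i)
  \<comment> \<open>\<open>dE (s a)\<close> may differ from \<open>s (dA a)\<close>, but both lie
    over \<open>dA a\<close>, and \<open>i_l\<close> makes the action depend only on the
    projection.\<close>
  also have "\<dots> = i (l a (dM m) + l (dA a) m)"
    using i_l[of "dE (s a)" m] by (simp add: additive_simps E_s_i p_dE p_s)
  finally show "dM (l a m) = l a (dM m) + l (dA a) m"
    using inj_i by (simp add: inj_eq)
  have "i (dM (r m a)) = dE (E (i m) (s a))"
    by (simp add: E_i_s dE_i)
  also have "\<dots> = E (i m) (dE (s a)) + E (i (dM m)) (s a)"
    by (simp add: dE dE_i)
  also have "\<dots> = i (r m (dA a) + r (dM m) a)"
    using i_r[of m "dE (s a)"] by (simp add: additive_simps E_i_s p_dE p_s)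
  finally show "dM (r m a) = r m (dA a) + r (dM m) a"
    using inj_i by (simp add: inj_eq)
qed

text \<open>Here \<open>h\<close> measures how far \<open>dE\<close> is from commuting with the
  section. After applying \<open>i\<close>, every term is a product in the middle term or a value of
  \<open>s\<close> or \<open>dE\<close>, and the two derivation rules make both sides agree.\<close>

lemma lift_coboundary:
  assumes dE: "\<And>x y. dE (E x y) = E x (dE y) + E (dE x) y" and "additive dE"
    and dE_i: "\<And>m. dE (i m) = i (dM m)" and p_dE: "\<And>e. p (dE e) = dA (p e)"
    and dA: "\<And>a b. dA (A a b) = A a (dA b) + A (dA a) b"
    and h: "\<And>a. i (h a) = s (dA a) - dE (s a)"
  shows "dM (factor_set a b) - factor_set (dA a) b - factor_set a (dA b)
    = - l a (h b) + h (A a b) - r (h a) b"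
proof -
  have "i (dM (factor_set a b)) = dE (E (s a) (s b)) - dE (s (A a b))"
    using \<open>additive dE\<close> by (simp add: dE_i[symmetric] i_factor_set additive.diff)
  then have "i (dM (factor_set a b) - factor_set (dA a) b - factor_set a (dA b))
    = i (- l a (h b) + h (A a b) - r (h a) b)"
    by (simp add: additive_simps E_s_i[symmetric] E_i_s[symmetric] i_factor_set h dE dA)
  then show ?thesis
    using inj_i by (simp only: inj_eq)
qed

text \<open>Converse direction: the product rule is checked in the coordinates
  \<open>i m + s a\<close>. Its \<open>A\<close>-part is the derivation rule for \<open>dA\<close>;
  its \<open>M\<close>-part combines \<open>dl\<close>, \<open>dr\<close> and
  \<open>cob\<close>.\<close>

lemma lift_derivation:
  assumes dE: "\<And>m a. dE (i m + s a) = i (dM m) + s (dA a) - i (h a)"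
    and "additive dM" and "\<And>a. additive (l a)" and "\<And>b. additive (\<lambda>m. r m b)"
    and dA: "\<And>a b. dA (A a b) = A a (dA b) + A (dA a) b"
    and dl: "\<And>a m. dM (l a m) = l a (dM m) + l (dA a) m"
    and dr: "\<And>a m. dM (r m a) = r m (dA a) + r (dM m) a"
    and cob: "\<And>a b. dM (factor_set a b) - factor_set (dA a) b - factor_set a (dA b)
      = - l a (h b) + h (A a b) - r (h a) b"
  shows "dE (E x y) = E x (dE y) + E (dE x) y"
proof -
  define a b where "a = p x" and "b = p y"
  obtain m n where x: "x = i m + s a" and y: "y = i n + s b"
    using decomp unfolding a_def b_def by metis
  have E_split: "E (i m + s a) (i n + s b) = i (r m b + l a n + factor_set a b) + s (A a b)" for m a n b
    by (simp add: additive_simps E_i_i E_s_i E_i_s E_s_s)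
  have dE': "dE (i m + s a) = i (dM m - h a) + s (dA a)" for m a
    by (simp add: dE additive_simps)
  have fs: "dM (factor_set a b)
      = factor_set (dA a) b + factor_set a (dA b) - l a (h b) + h (A a b) - r (h a) b"
    using cob[of a b] by (simp add: algebra_simps)
  \<comment> \<open>This is the \<open>M\<close>-part of the product rule, read off from
    \<open>E_split\<close> and \<open>dE'\<close>.\<close>
  have "dM (r m b + l a n + factor_set a b) - h (A a b)
      = (r m (dA b) + l a (dM n - h b) + factor_set a (dA b))
        + (r (dM m - h a) b + l (dA a) n + factor_set (dA a) b)"
    by (simp add: additive.add[OF \<open>additive dM\<close>] additive.diff[OF assms(3)] additive.diff[OF assms(4)]
      dl dr fs)
  then show ?thesis
    unfolding x y E_split dE' dA
    by (simp only: additive.add[OF additive_i, symmetric] additive.add[OF additive_s])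
      (simp add: additive_simps)
qed

end


section \<open>Linear maps and coboundaries\<close>

lemma linear_additive: "Vector_Spaces.linear s1 s2 f \<Longrightarrow> additive f"
  by (simp add: additive_def Vector_Spaces.linear_iff)

text \<open>Transfers linearity to maps defined through \<open>inv i\<close>, where only the
  composite with \<open>i\<close> has an explicit formula.\<close>

lemma linear_cancel_inj:
  assumes i: "Vector_Spaces.linear s2 s3 i" "inj i" and "Vector_Spaces.linear s1 s3 (\<lambda>x. i (h x))"
  shows "Vector_Spaces.linear s1 s2 h"
  using assms unfolding Vector_Spaces.linear_iff by (metis inj_eq)

lemma
  assumes "Vector_Spaces.linear s1 s2 f" and "Vector_Spaces.linear s1 s2 g"
  shows linear_fun_add: "Vector_Spaces.linear s1 s2 (\<lambda>x. f x + g x)"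
    and linear_fun_diff: "Vector_Spaces.linear s1 s2 (\<lambda>x. f x - g x)"
proof -
  interpret vector_space_pair s1 s2
    using assms(1) by (simp add: Vector_Spaces.linear_iff vector_space_pair_def)
  show "Vector_Spaces.linear s1 s2 (\<lambda>x. f x + g x)" "Vector_Spaces.linear s1 s2 (\<lambda>x. f x - g x)"
    using assms by (auto intro: linear_compose_add linear_compose_sub)
qed

lemma linear_fun_comp:
  "Vector_Spaces.linear s1 s2 f \<Longrightarrow> Vector_Spaces.linear s2 s3 g \<Longrightarrow> Vector_Spaces.linear s1 s3 (\<lambda>x. g (f x))"
  by (simp add: Vector_Spaces.linear_iff)

lemma bilinear_map_linear:
  assumes "bilinear_map s1 s2 s3 b"
  shows "Vector_Spaces.linear s2 s3 (b x)" and "Vector_Spaces.linear s1 s3 (\<lambda>x. b x y)"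
  using assms by (simp_all add: bilinear_map_def)

lemma bilinear_map_additive:
  assumes "bilinear_map s1 s2 s3 b"
  shows "additive (b x)" and "additive (\<lambda>x. b x y)"
  using bilinear_map_linear[OF assms] linear_additive by blast+

lemma bilinear_coboundary:
  assumes "Vector_Spaces.linear sA sM h" and "bilinear_map sA sM sM l" and "bilinear_map sM sA sM r"
    and "bilinear_map sA sA sA b"
  shows "bilinear_map sA sA sM (\<lambda>x y. - l x (h y) + h (b x y) - r (h x) y)"
proof -
  have "Vector_Spaces.linear sA sM (\<lambda>y. h (b x y) - l x (h y) - r (h x) y)" for x
    by (intro linear_fun_diff linear_fun_comp[OF bilinear_map_linear(1)[OF assms(4)] assms(1)]
      linear_fun_comp[OF assms(1) bilinear_map_linear(1)[OF assms(2)]]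
      bilinear_map_linear(1)[OF assms(3)])
  moreover have "Vector_Spaces.linear sA sM (\<lambda>x. h (b x y) - l x (h y) - r (h x) y)" for y
    by (intro linear_fun_diff linear_fun_comp[OF bilinear_map_linear(2)[OF assms(4)] assms(1)]
      linear_fun_comp[OF assms(1) bilinear_map_linear(2)[OF assms(3)]]
      bilinear_map_linear(2)[OF assms(2)])
  ultimately show ?thesis
    by (simp add: bilinear_map_def)
qed

section \<open>Coboundaries of a representation and the zero class\<close>

context AWB_rep
begin

lemmas lact_additive = bilinear_map_additive[OF bilinear_lact]
lemmas ract_additive = bilinear_map_additive[OF bilinear_ract]
lemmas lbr_additive = bilinear_map_additive[OF bilinear_lbr]
lemmas rbr_additive = bilinear_map_additive[OF bilinear_rbr]

lemmas action_simps =
  additive.add[OF lact_additive(1)] additive.diff[OF lact_additive(1)]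
  additive.minus[OF lact_additive(1)] additive.zero[OF lact_additive(1)]
  additive.add[OF ract_additive(2)] additive.diff[OF ract_additive(2)]
  additive.minus[OF ract_additive(2)] additive.zero[OF ract_additive(2)]
  additive.add[OF lbr_additive(1)] additive.diff[OF lbr_additive(1)]
  additive.minus[OF lbr_additive(1)] additive.zero[OF lbr_additive(1)]
  additive.add[OF rbr_additive(2)] additive.diff[OF rbr_additive(2)]
  additive.minus[OF rbr_additive(2)] additive.zero[OF rbr_additive(2)]

text \<open>Substituting the definition, all terms in \<open>h\<close> cancel by associativity, the
  bracket rule and the six representation identities. The relation \<open>cohomologous\<close>
  requires both its members to be cocycles.\<close>

lemma coboundary_cocycle:
  assumes h: "Vector_Spaces.linear (smul A) (rsmul M) h"
  shows "coboundary A M h \<in> cocycles0 A M"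
proof -
  have h_add: "h (x + y) = h x + h y" for x y
    using linear_additive[OF h] by (rule additive.add)
  show ?thesis
    unfolding coboundary_def cocycles0_def cochains0_def
    using bilinear_coboundary[OF h bilinear_lact bilinear_ract bilinear_mult]
      bilinear_coboundary[OF h bilinear_lbr bilinear_rbr bilinear_brkt]
    by (simp add: action_simps h_add mult_assoc brkt_mult lact_mult ract_mult ract_lact
      rbr_lact rbr_ract lbr_mult algebra_simps)
qed

lemma linear_zero: "Vector_Spaces.linear (smul A) (rsmul M) (\<lambda>_. 0)"
  using vector_space_smul vector_space_rsmul
  by (intro vector_space_pair.linear_zero) (simp add: vector_space_pair_def)

lemma coboundary_zero: "coboundary A M (\<lambda>_. 0) = (\<lambda>_ _. 0, \<lambda>_ _. 0)"
  by (simp add: coboundary_def action_simps)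

lemma coboundary_diff:
  assumes "coboundary A M h = (f, g)" and "coboundary A M h' = (f', g')"
  shows "coboundary A M (\<lambda>a. h a - h' a) = (\<lambda>a b. f a b - f' a b, \<lambda>a b. g a b - g' a b)"
proof -
  have "f = fst (coboundary A M h)" "g = snd (coboundary A M h)"
    "f' = fst (coboundary A M h')" "g' = snd (coboundary A M h')"
    using assms by simp_all
  then show ?thesis
    by (simp add: coboundary_def action_simps fun_eq_iff
      additive.diff[OF ract_additive(2)] additive.diff[OF rbr_additive(2)])
qed

text \<open>\<open>c\<close> ranges over all pairs of functions: if it is not a cocycle, its class
  is empty while \<open>H1_zero\<close> contains the zero pair, and every coboundary is a
  cocycle.\<close>

lemma cl_eq_H1_zero_iff:
  "cl A M c = H1_zero A M
    \<longleftrightarrow> (\<exists>h. Vector_Spaces.linear (smul A) (rsmul M) h \<and> c = coboundary A M h)"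
proof
  let ?Z = "(\<lambda>_ _. 0, \<lambda>_ _. 0) :: ('a, 'm) cochain0"
  assume "cl A M c = H1_zero A M"
  moreover have "?Z \<in> H1_zero A M"
    using coboundary_cocycle[OF linear_zero] linear_zero coboundary_zero
    unfolding H1_zero_def cl_def cohomologous_def by auto
  ultimately have "(c, ?Z) \<in> cohomologous A M"
    by (simp add: cl_def flip: Image_singleton_iff)
  then show "\<exists>h. Vector_Spaces.linear (smul A) (rsmul M) h \<and> c = coboundary A M h"
    unfolding cohomologous_def by auto
next
  assume "\<exists>h. Vector_Spaces.linear (smul A) (rsmul M) h \<and> c = coboundary A M h"
  then obtain h where h: "Vector_Spaces.linear (smul A) (rsmul M) h" and c: "c = coboundary A M h"
    by blast
  obtain f g where fg: "c = (f, g)" by fastforce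
  have cocycles: "(f, g) \<in> cocycles0 A M" "(\<lambda>_ _. 0, \<lambda>_ _. 0) \<in> cocycles0 A M"
    using coboundary_cocycle[OF h] coboundary_cocycle[OF linear_zero]
    by (simp_all add: c[symmetric] fg coboundary_zero)
  \<comment> \<open>The two classes are compared member by member: subtracting \<open>h\<close>
    from, or adding it to, a cochain \<open>k\<close> passes between the two conditions.\<close>
  have "((f, g), (f', g')) \<in> cohomologous A M
      \<longleftrightarrow> ((\<lambda>_ _. 0, \<lambda>_ _. 0), (f', g')) \<in> cohomologous A M" for f' g'
  proof -
    have "(\<exists>k. Vector_Spaces.linear (smul A) (rsmul M) k \<and>
          (\<lambda>a b. f a b - f' a b, \<lambda>a b. g a b - g' a b) = coboundary A M k)
      \<longleftrightarrow> (\<exists>k. Vector_Spaces.linear (smul A) (rsmul M) k \<and>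
          (\<lambda>a b. 0 - f' a b, \<lambda>a b. 0 - g' a b) = coboundary A M k)" (is "?L \<longleftrightarrow> ?R")
    proof
      assume ?L
      then obtain k where k: "Vector_Spaces.linear (smul A) (rsmul M) k"
        "coboundary A M k = (\<lambda>a b. f a b - f' a b, \<lambda>a b. g a b - g' a b)" by metis
      show ?R
        using linear_fun_diff[OF k(1) h] coboundary_diff[OF k(2) c[symmetric, unfolded fg]]
        by (intro exI[of _ "\<lambda>a. k a - h a"]) (simp add: algebra_simps)
    next
      assume ?R
      then obtain k where k: "Vector_Spaces.linear (smul A) (rsmul M) k"
        "coboundary A M k = (\<lambda>a b. 0 - f' a b, \<lambda>a b. 0 - g' a b)" by metis
      \<comment> \<open>The sum of \<open>h\<close> and \<open>k\<close> is written with differences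
        so that \<open>coboundary_diff\<close> applies twice.\<close>
      have "coboundary A M (\<lambda>a. h a - (0 - k a))
        = (\<lambda>a b. f a b - (0 - (0 - f' a b)), \<lambda>a b. g a b - (0 - (0 - g' a b)))"
        by (rule coboundary_diff[OF c[symmetric, unfolded fg]
          coboundary_diff[OF coboundary_zero k(2)]])
      then show ?L
        using linear_fun_diff[OF h linear_fun_diff[OF linear_zero k(1)]]
        by (intro exI[of _ "\<lambda>a. h a - (0 - k a)"]) simp
    qed
    then show ?thesis
      unfolding cohomologous_def using cocycles by simp
  qed
  then show "cl A M c = H1_zero A M"
    unfolding H1_zero_def cl_def fg by auto
qed

end


section \<open>Extensible pairs\<close>

context abelian_extension
begin

lemma linear_i: "Vector_Spaces.linear (rsmul M) (smul E) i"
  and linear_p: "Vector_Spaces.linear (smul E) (smul A) p"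
  using hom_i hom_p by (simp_all add: awb_hom_def abelian_awb_def)

text \<open>A linear surjection of vector spaces splits; this gives the choice in
  \<open>wells_map\<close> a witness.\<close>

lemma ex_linear_section: "\<exists>s. linear_section A E p s"
proof -
  interpret vector_space_pair "smul E" "smul A"
    using linear_p by (simp add: Vector_Spaces.linear_iff vector_space_pair_def)
  show ?thesis
    using linear_surjective_right_inverse[OF linear_p surj_p]
    by (auto simp: linear_section_def)
qed

lemma biadditive_extensions:
  assumes "linear_section A E p s"
  shows "biadditive_extension i p s (mult E) (mult A) (lact M) (ract M)"
    and "biadditive_extension i p s (brkt E) (brkt A) (lbr M) (rbr M)"
proof -
  have s: "additive s" "\<And>a. p (s a) = a"
    using assms linear_additive by (auto simp: linear_section_def fun_eq_iff)
  have p_hom: "p (mult E x y) = mult A (p x) (p y)" "p (brkt E x y) = brkt A (p x) (p y)" for x y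
    using hom_p by (simp_all add: awb_hom_def)
  show "biadditive_extension i p s (mult E) (mult A) (lact M) (ract M)"
    by (rule biadditive_extension.intro)
      (rule p_hom linear_additive[OF linear_i] linear_additive[OF linear_p] s inj_i exact
      bilinear_map_additive[OF E.bilinear_mult] lact_additive induced_lact induced_ract)+
  show "biadditive_extension i p s (brkt E) (brkt A) (lbr M) (rbr M)"
    by (rule biadditive_extension.intro)
      (rule p_hom linear_additive[OF linear_i] linear_additive[OF linear_p] s inj_i exact
      bilinear_map_additive[OF E.bilinear_brkt] lbr_additive induced_lbr induced_rbr)+
qed

text \<open>The section \<open>s\<close> is arbitrary, so the result applies to whichever one
  \<open>wells_map\<close> selects.\<close>

lemma extensible_iff_coboundary:
  assumes s: "linear_section A E p s"
    and dM: "dM \<in> Der_AWB (rep_awb M)" and dA: "dA \<in> Der_AWB A"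
  shows "extensible E i p (dM, dA) \<longleftrightarrow> (dM, dA) \<in> D_AWB A M \<and>
    (\<exists>h. Vector_Spaces.linear (smul A) (rsmul M) h \<and>
      theta_cochain (dM, dA) (section_cocycle A E i s) = coboundary A M h)"
proof -
  interpret mul: biadditive_extension i p s "mult E" "mult A" "lact M" "ract M"
    by (rule biadditive_extensions(1)[OF s])
  interpret br: biadditive_extension i p s "brkt E" "brkt A" "lbr M" "rbr M"
    by (rule biadditive_extensions(2)[OF s])
  have linear_s: "Vector_Spaces.linear (smul A) (smul E) s"
    using s by (simp add: linear_section_def)
  have linear_dM: "Vector_Spaces.linear (rsmul M) (rsmul M) dM"
    using dM by (simp add: Der_AWB_def abelian_awb_def)
  have linear_dA: "Vector_Spaces.linear (smul A) (smul A) dA"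
    and dA_mult: "\<And>a b. dA (mult A a b) = mult A a (dA b) + mult A (dA a) b"
    and dA_brkt: "\<And>a b. dA (brkt A a b) = brkt A a (dA b) + brkt A (dA a) b"
    using dA by (simp_all add: Der_AWB_def)
  have theta: "theta_cochain (dM, dA) (section_cocycle A E i s) = coboundary A M h \<longleftrightarrow>
      (\<forall>a b. dM (mul.factor_set a b) - mul.factor_set (dA a) b - mul.factor_set a (dA b)
        = - lact M a (h b) + h (mult A a b) - ract M (h a) b) \<and>
      (\<forall>a b. dM (br.factor_set a b) - br.factor_set (dA a) b - br.factor_set a (dA b)
        = - lbr M a (h b) + h (brkt A a b) - rbr M (h a) b)" for h
    by (simp add: theta_cochain_def section_cocycle_def coboundary_def fun_eq_iff
      mul.factor_set_def br.factor_set_def)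
  show ?thesis
  proof (intro iffI conjI)
    assume "extensible E i p (dM, dA)"
    then obtain dE where "dE \<in> Der_AWB E" and "dE \<circ> i = i \<circ> dM" "p \<circ> dE = dA \<circ> p"
      by (auto simp: extensible_def)
    then have linear_dE: "Vector_Spaces.linear (smul E) (smul E) dE"
      and dE_mult: "\<And>x y. dE (mult E x y) = mult E x (dE y) + mult E (dE x) y"
      and dE_brkt: "\<And>x y. dE (brkt E x y) = brkt E x (dE y) + brkt E (dE x) y"
      and dE_i: "\<And>m. dE (i m) = i (dM m)" and p_dE: "\<And>e. p (dE e) = dA (p e)"
      by (simp_all add: Der_AWB_def fun_eq_iff)
    show "(dM, dA) \<in> D_AWB A M"
      using dM dA mul.lift_compatible[of dE dM dA, OF dE_mult dE_i p_dE]
        br.lift_compatible[of dE dM dA, OF dE_brkt dE_i p_dE]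
      by (simp add: D_AWB_def)
    \<comment> \<open>Both terms lie over \<open>dA a\<close>, so their difference is in the image
      of \<open>i\<close>. As \<open>h\<close> depends only on \<open>dE\<close> and
      \<open>s\<close>, the same \<open>h\<close> serves product and bracket.\<close>
    define h where "h a = inv i (s (dA a) - dE (s a))" for a
    have i_h: "i (h a) = s (dA a) - dE (s a)" for a
      unfolding h_def by (rule mul.i_inv) (simp add: mul.additive_simps mul.p_s p_dE)
    have "Vector_Spaces.linear (smul A) (smul E) (\<lambda>a. i (h a))"
      unfolding i_h
      by (rule linear_fun_diff[OF linear_fun_comp[OF linear_dA linear_s]
        linear_fun_comp[OF linear_s linear_dE]])
    then have "Vector_Spaces.linear (smul A) (rsmul M) h"
      by (rule linear_cancel_inj[OF linear_i inj_i])
    moreover have "theta_cochain (dM, dA) (section_cocycle A E i s) = coboundary A M h"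
      unfolding theta
      using mul.lift_coboundary[of dE dM dA h, OF dE_mult linear_additive[OF linear_dE] dE_i p_dE
            dA_mult i_h]
        br.lift_coboundary[of dE dM dA h, OF dE_brkt linear_additive[OF linear_dE] dE_i p_dE
            dA_brkt i_h]
      by blast
    ultimately show "\<exists>h. Vector_Spaces.linear (smul A) (rsmul M) h \<and>
        theta_cochain (dM, dA) (section_cocycle A E i s) = coboundary A M h"
      by blast
  next
    assume "(dM, dA) \<in> D_AWB A M \<and> (\<exists>h. Vector_Spaces.linear (smul A) (rsmul M) h \<and>
      theta_cochain (dM, dA) (section_cocycle A E i s) = coboundary A M h)"
    then obtain h where D: "(dM, dA) \<in> D_AWB A M"
      and linear_h: "Vector_Spaces.linear (smul A) (rsmul M) h"
      and h: "theta_cochain (dM, dA) (section_cocycle A E i s) = coboundary A M h"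
      by blast
    \<comment> \<open>\<open>q\<close> is the projection to \<open>M\<close> along the section; with
      \<open>p\<close> it supplies the coordinates in which \<open>dE\<close> is defined.\<close>
    define q where "q e = inv i (e - s (p e))" for e
    have i_q: "i (q e) = e - s (p e)" for e
      unfolding q_def by (rule mul.i_inv) (simp add: mul.additive_simps mul.p_s)
    have linear_id: "Vector_Spaces.linear (smul E) (smul E) (\<lambda>e. e)"
      using E.vector_space_smul by (simp add: Vector_Spaces.linear_iff)
    have "Vector_Spaces.linear (smul E) (smul E) (\<lambda>e. i (q e))"
      unfolding i_q by (rule linear_fun_diff[OF linear_id linear_fun_comp[OF linear_p linear_s]])
    then have linear_q: "Vector_Spaces.linear (smul E) (rsmul M) q"
      by (rule linear_cancel_inj[OF linear_i inj_i])
    define dE where "dE e = i (dM (q e)) + s (dA (p e)) - i (h (p e))" for e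
    have linear_dE: "Vector_Spaces.linear (smul E) (smul E) dE"
      unfolding dE_def
      by (intro linear_fun_diff linear_fun_add linear_fun_comp[OF _ linear_i]
        linear_fun_comp[OF linear_q linear_dM] linear_fun_comp[OF linear_p linear_h]
        linear_fun_comp[OF linear_fun_comp[OF linear_p linear_dA] linear_s])
    have p_is: "p (i m + s a) = a" for m a
      by (simp add: mul.additive_simps mul.p_s)
    then have q_is: "q (i m + s a) = m" for m a
      by (simp add: q_def inj_i)
    have dE_is: "dE (i m + s a) = i (dM m) + s (dA a) - i (h a)" for m a
      by (simp add: dE_def p_is q_is)
    have "dE (mult E x y) = mult E x (dE y) + mult E (dE x) y" for x y
      by (rule mul.lift_derivation[of dE dM dA h, OF dE_is linear_additive[OF linear_dM]
            lact_additive(1) ract_additive(2) dA_mult])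
        (use D h theta in \<open>auto simp: D_AWB_def\<close>)
    moreover have "dE (brkt E x y) = brkt E x (dE y) + brkt E (dE x) y" for x y
      by (rule br.lift_derivation[of dE dM dA h, OF dE_is linear_additive[OF linear_dM]
            lbr_additive(1) rbr_additive(2) dA_brkt])
        (use D h theta in \<open>auto simp: D_AWB_def\<close>)
    ultimately have "dE \<in> Der_AWB E"
      using linear_dE by (simp add: Der_AWB_def)
    moreover have "dE \<circ> i = i \<circ> dM"
    proof
      fix m
      show "(dE \<circ> i) m = (i \<circ> dM) m"
        \<comment> \<open>With \<open>a = 0\<close> the terms \<open>s (dA a)\<close> and
          \<open>i (h a)\<close> vanish.\<close>
        using dE_is[of m 0] linear_additive[OF linear_dA] linear_additive[OF linear_h]
        by (simp add: mul.additive_simps additive.zero)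
    qed
    moreover have "p \<circ> dE = dA \<circ> p"
      by (simp add: fun_eq_iff dE_def mul.additive_simps mul.p_s)
    ultimately show "extensible E i p (dM, dA)"
      by (auto simp: extensible_def)
  qed
qed

end

theorem theorem3p7:
  fixes A :: "('k::field, 'a::ab_group_add) awb"
    and M :: "('k, 'a, 'm::ab_group_add) awb_rep"
    and E :: "('k, 'e::ab_group_add) awb"
    and i :: "'m \<Rightarrow> 'e" and p :: "'e \<Rightarrow> 'a"
    and dM :: "'m \<Rightarrow> 'm" and dA :: "'a \<Rightarrow> 'a"
  assumes "abelian_extension A M E i p"
    and "(dM, dA) \<in> Der_AWB (rep_awb M) \<times> Der_AWB A"
  shows "extensible E i p (dM, dA) \<longleftrightarrow>
         (dM, dA) \<in> D_AWB A M \<and> wells_map A M E i p (dM, dA) = H1_zero A M"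
proof -
  interpret abelian_extension A M E i p by (rule assms(1))
  show ?thesis
    using extensible_iff_coboundary[OF someI_ex[OF ex_linear_section]] assms(2)
    by (simp add: wells_map_def cl_eq_H1_zero_iff)
qed

end
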